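(* Let $r\ge 1$, let $\lambda_1,\dots,\lambda_r\in\mathbb{C}$ be pairwise distinct, let $m_1,\dots,m_r\in\mathbb{N}$ be positive integers, and let \[ p(D)=(D-\lambda_1)^{m_1}(D-\lambda_2)^{m_2}\cdots(D-\lambda_r)^{m_r}\in\mathbb{C}[D]. \] Then \[ \ker p(D)=\bigoplus_{j=1}^r \ker (D-\lambda_j)^{m_j}. \] In particular, the set $\{x^k e^{\lambda_j x} : 0\le k\le m_j-1,\; 1\le j\le r\}$ is a basis of $\ker p(D)$ over $\mathbb{C}$, so that \[ \ker p(D)=\operatorname{span}_{\mathbb{C}}\{x^k e^{\lambda_j x} : 0\le k\le m_j-1,\; 1\le j\le r\}. \]
   Context: $C^\infty(\mathbb{R})$ is the complex vector space of infinitely differentiable functions $\mathbb{R}\to\mathbb{C}$, and $D=\frac{d}{dx}$. A polynomial $q(D)\in\mathbb{C}[D]$ acts on $C^\infty(\mathbb{R})$ as the differential operator $q\left(\frac{d}{dx}\right)$, and $\ker q(D)$ denotes the kernel of $q(D):C^\infty(\mathbb{R})\to C^\infty(\mathbb{R})$. *)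

theory Defs
  imports "HOL-Analysis.Analysis" "HOL-Library.Function_Algebras"
    "HOL-Computational_Algebra.Polynomial"
begin

definition fun_scale :: "complex \<Rightarrow> (real \<Rightarrow> complex) \<Rightarrow> real \<Rightarrow> complex"
  where "fun_scale c f = (\<lambda>x. c * f x)"

text \<open>Addition and zero on functions are the pointwise ones of \<^theory>\<open>HOL-Library.Function_Algebras\<close>.\<close>

global_interpretation cfun: vector_space fun_scale
  by unfold_locales (auto simp: fun_scale_def algebra_simps)

definition Diff :: "(real \<Rightarrow> complex) \<Rightarrow> real \<Rightarrow> complex"
  where "Diff f = (\<lambda>x. vector_derivative f (at x))"

definition C_infinity :: "(real \<Rightarrow> complex) set"
  where "C_infinity = {f. \<forall>n x. ((Diff ^^ n) f) differentiable (at x)}"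

definition poly_Diff :: "complex poly \<Rightarrow> (real \<Rightarrow> complex) \<Rightarrow> real \<Rightarrow> complex"
  where "poly_Diff q f = (\<Sum>i\<le>degree q. fun_scale (coeff q i) ((Diff ^^ i) f))"

definition ker_Diff :: "complex poly \<Rightarrow> (real \<Rightarrow> complex) set"
  where "ker_Diff q = {f \<in> C_infinity. poly_Diff q f = 0}"

text \<open>Component families are extensional, so that uniqueness concerns only their values on the
  index set.\<close>

definition is_direct_sum ::
  "(real \<Rightarrow> complex) set \<Rightarrow> 'i set \<Rightarrow> ('i \<Rightarrow> (real \<Rightarrow> complex) set) \<Rightarrow> bool"
  where "is_direct_sum V I W \<longleftrightarrow>
    finite I \<and> cfun.subspace V \<and> (\<forall>i\<in>I. cfun.subspace (W i) \<and> W i \<subseteq> V) \<and>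
    (\<forall>v\<in>V. \<exists>!w. w \<in> (\<Pi>\<^sub>E i\<in>I. W i) \<and> v = (\<Sum>i\<in>I. w i))"

definition is_basis :: "(real \<Rightarrow> complex) set \<Rightarrow> (real \<Rightarrow> complex) set \<Rightarrow> bool"
  where "is_basis B V \<longleftrightarrow> B \<subseteq> V \<and> cfun.independent B \<and> V \<subseteq> cfun.span B"

lemma C_infinity_subspace: "cfun.subspace C_infinity"
proof -
  have add: "(Diff ^^ n) (f + g) = (Diff ^^ n) f + (Diff ^^ n) g"
    if "f \<in> C_infinity" "g \<in> C_infinity" for f g n
  proof (induction n)
    case (Suc n)
    have "((Diff ^^ n) f) differentiable (at x)" "((Diff ^^ n) g) differentiable (at x)" for x
      using that by (auto simp: C_infinity_def)
    then have "Diff ((Diff ^^ n) f + (Diff ^^ n) g) = Diff ((Diff ^^ n) f) + Diff ((Diff ^^ n) g)"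
      by (auto simp: Diff_def plus_fun_def fun_eq_iff vector_derivative_works
          intro!: vector_derivative_at has_vector_derivative_add)
    then show ?case
      by (simp only: funpow.simps o_apply Suc)
  qed auto
  have scale: "(Diff ^^ n) (fun_scale c f) = fun_scale c ((Diff ^^ n) f)"
    if "f \<in> C_infinity" for f n c
  proof (induction n)
    case (Suc n)
    have "((Diff ^^ n) f) differentiable (at x)" for x
      using that by (auto simp: C_infinity_def)
    then have "Diff (fun_scale c ((Diff ^^ n) f)) = fun_scale c (Diff ((Diff ^^ n) f))"
      by (auto simp: Diff_def fun_scale_def fun_eq_iff vector_derivative_works
          intro!: vector_derivative_at has_vector_derivative_mult_right)
    then show ?case
      by (simp only: funpow.simps o_apply Suc)
  qed auto
  have zero: "(Diff ^^ n) 0 = 0" for n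
    by (induction n) (auto simp: Diff_def zero_fun_def)
  show ?thesis
    unfolding cfun.subspace_def
  proof (intro conjI ballI allI)
    show "0 \<in> C_infinity" using zero by (simp add: C_infinity_def) (simp add: zero_fun_def)
  next
    fix f g assume fg: "f \<in> C_infinity" "g \<in> C_infinity"
    then show "f + g \<in> C_infinity"
      using add[OF fg] by (auto simp: C_infinity_def plus_fun_def intro!: differentiable_add)
  next
    fix c f assume f: "f \<in> C_infinity"
    then show "fun_scale c f \<in> C_infinity"
      using scale[OF f] by (auto simp: C_infinity_def fun_scale_def intro!: differentiable_mult)
  qed
qed

lemma Diff_in_C_infinity:
  assumes "f \<in> C_infinity" shows "Diff f \<in> C_infinity"
proof -
  have "(Diff ^^ n) (Diff f) = (Diff ^^ Suc n) f" for n
    by (simp only: funpow_Suc_right o_apply)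
  then show ?thesis
    using assms by (auto simp: C_infinity_def simp del: funpow.simps)
qed

lemma poly_Diff_in_C_infinity:
  assumes "f \<in> C_infinity" shows "poly_Diff q f \<in> C_infinity"
proof -
  have "(Diff ^^ i) f \<in> C_infinity" for i
    by (induction i) (auto simp: assms Diff_in_C_infinity)
  then show ?thesis
    unfolding poly_Diff_def
    by (intro cfun.subspace_sum cfun.subspace_scale C_infinity_subspace) auto
qed

end

theory Submission
  imports Defs "HOL-Computational_Algebra.Field_as_Ring"
    "HOL-Computational_Algebra.Polynomial_Factorial"
begin

text \<open>Polynomials act on smooth functions through a ring homomorphism, so a Bezout identity
  \<open>a p + b q = 1\<close> splits \<open>ker (p q)\<close> into \<open>ker p\<close> and \<open>ker q\<close>, with the components of \<open>f\<close> given by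
  \<open>b q f\<close> and \<open>a p f\<close>. On functions \<open>P(x) e\<^sup>l\<^sup>x\<close> with \<open>P\<close> a polynomial, \<open>D - l\<close> acts as
  differentiation of \<open>P\<close>; since polynomials have polynomial antiderivatives, induction on \<open>m\<close>
  shows that \<open>ker (D - l)\<^sup>m\<close> consists of such functions with \<open>deg P < m\<close>.\<close>

section \<open>The action of polynomials in D on smooth functions\<close>

lemma Diff_add:
  assumes "f \<in> C_infinity" "g \<in> C_infinity"
  shows "Diff (f + g) = Diff f + Diff g"
proof -
  have "f differentiable (at x)" "g differentiable (at x)" for x
    using assms by (auto simp: C_infinity_def dest: spec[of _ 0])
  then show ?thesis
    by (auto simp: Diff_def plus_fun_def fun_eq_iff vector_derivative_works
        intro!: vector_derivative_at has_vector_derivative_add)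
qed

lemma Diff_scale:
  assumes "f \<in> C_infinity"
  shows "Diff (fun_scale c f) = fun_scale c (Diff f)"
proof -
  have "f differentiable (at x)" for x
    using assms by (auto simp: C_infinity_def dest: spec[of _ 0])
  then show ?thesis
    by (auto simp: Diff_def fun_scale_def fun_eq_iff vector_derivative_works
        intro!: vector_derivative_at has_vector_derivative_mult_right)
qed

text \<open>All iterated derivatives stay inside \<open>V\<close>. This yields smoothness of a whole
  family of functions at once, with no closed formula for the higher derivatives.\<close>

lemma Diff_closed_subset_C_infinity:
  assumes "\<And>f x. f \<in> V \<Longrightarrow> f differentiable (at x)" "\<And>f. f \<in> V \<Longrightarrow> Diff f \<in> V"
  shows "V \<subseteq> C_infinity"
proof -
  have "(Diff ^^ n) f \<in> V" if "f \<in> V" for f n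
    using that assms(2) by (induction n) auto
  then show ?thesis
    using assms(1) by (auto simp: C_infinity_def)
qed

lemmas C_infinity_closed = C_infinity_subspace[THEN cfun.subspace_add]
  C_infinity_subspace[THEN cfun.subspace_scale] Diff_in_C_infinity poly_Diff_in_C_infinity

text \<open>Coefficients above the degree vanish. A common summation bound allows polynomials of
  different degrees to be compared term by term.\<close>

lemma poly_Diff_eq_sum:
  assumes "degree q \<le> n"
  shows "poly_Diff q f = (\<Sum>i\<le>n. fun_scale (coeff q i) ((Diff ^^ i) f))"
  unfolding poly_Diff_def
  by (rule sum.mono_neutral_left) (use assms in \<open>auto simp: coeff_eq_0\<close>)

lemma poly_Diff_0 [simp]: "poly_Diff 0 f = 0"
  by (simp add: poly_Diff_def)

text \<open>Horner form that drives the inductions on polynomials below. Because the derivative is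
  taken on the argument and not on the result, this is a pure index shift and holds without
  smoothness of \<open>f\<close>; the inductions then generalise over the function.\<close>

lemma poly_Diff_pCons: "poly_Diff (pCons a q) f = fun_scale a f + poly_Diff q (Diff f)"
proof -
  have "poly_Diff (pCons a q) f
      = (\<Sum>i\<le>Suc (degree q). fun_scale (coeff (pCons a q) i) ((Diff ^^ i) f))"
    by (rule poly_Diff_eq_sum) (rule degree_pCons_le)
  also have "\<dots> = fun_scale a f + poly_Diff q (Diff f)"
    unfolding poly_Diff_def sum.atMost_Suc_shift by (simp add: funpow_Suc_right del: funpow.simps)
  finally show ?thesis .
qed

lemma poly_Diff_1 [simp]: "poly_Diff 1 f = f"
  by (simp add: poly_Diff_def)

lemma poly_Diff_add_poly: "poly_Diff (p + q) f = poly_Diff p f + poly_Diff q f"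
proof -
  have "degree (p + q) \<le> max (degree p) (degree q)"
    by (rule degree_add_le_max)
  then show ?thesis
    by (simp add: poly_Diff_eq_sum[of _ "max (degree p) (degree q)"]
        cfun.scale_left_distrib sum.distrib)
qed

lemma poly_Diff_smult: "poly_Diff (smult c q) f = fun_scale c (poly_Diff q f)"
  by (simp add: poly_Diff_eq_sum[of _ "degree q"] degree_smult_le cfun.scale_sum_right)

lemma poly_Diff_add:
  assumes "f \<in> C_infinity" "g \<in> C_infinity"
  shows "poly_Diff q (f + g) = poly_Diff q f + poly_Diff q g"
  using assms
proof (induction q arbitrary: f g)
  case (pCons a q)
  then show ?case
    by (simp only: poly_Diff_pCons Diff_add C_infinity_closed cfun.scale_right_distrib add_ac)
qed auto

lemma poly_Diff_scale:
  assumes "f \<in> C_infinity"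
  shows "poly_Diff q (fun_scale c f) = fun_scale c (poly_Diff q f)"
  using assms
proof (induction q arbitrary: f)
  case (pCons a q)
  then show ?case
    by (simp only: poly_Diff_pCons Diff_scale C_infinity_closed cfun.scale_right_distrib
        cfun.scale_scale mult.commute)
qed auto

lemma Diff_poly_Diff:
  assumes "f \<in> C_infinity"
  shows "Diff (poly_Diff q f) = poly_Diff q (Diff f)"
  using assms
proof (induction q arbitrary: f)
  case 0
  show ?case by (simp add: Diff_def zero_fun_def)
next
  case (pCons a q)
  then show ?case
    by (simp only: poly_Diff_pCons Diff_add Diff_scale C_infinity_closed)
qed

text \<open>Multiplicativity rests on \<open>Diff\<close> commuting with \<open>poly_Diff q\<close>,
  which in turn uses linearity of \<open>Diff\<close> and hence smoothness.\<close>

lemma poly_Diff_mult: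
  assumes "f \<in> C_infinity"
  shows "poly_Diff (p * q) f = poly_Diff p (poly_Diff q f)"
  using assms
proof (induction p arbitrary: f)
  case (pCons a p)
  then show ?case
    by (simp add: poly_Diff_pCons poly_Diff_add_poly poly_Diff_smult Diff_poly_Diff C_infinity_closed)
qed auto

lemma poly_Diff_zero_fun [simp]: "poly_Diff q 0 = 0"
  using poly_Diff_scale[OF cfun.subspace_0[OF C_infinity_subspace], of q 0] by simp

section \<open>Kernels of products of pairwise coprime polynomials\<close>

lemma ker_Diff_subspace: "cfun.subspace (ker_Diff q)"
  using C_infinity_subspace
  by (auto simp: cfun.subspace_def ker_Diff_def poly_Diff_add poly_Diff_scale)

lemma ker_Diff_mono:
  assumes "q dvd p"
  shows "ker_Diff q \<subseteq> ker_Diff p"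
proof -
  obtain s where "p = s * q"
    using assms by (metis dvdE mult.commute)
  then show ?thesis
    by (auto simp: ker_Diff_def poly_Diff_mult)
qed

text \<open>Both summands of the Bezout identity annihilate \<open>f\<close>, while their sum acts
  as the identity.\<close>

lemma ker_Diff_coprime_Int:
  assumes "coprime p q" "f \<in> ker_Diff p" "f \<in> ker_Diff q"
  shows "f = 0"
proof -
  obtain a b where "a * p + b * q = 1"
    using assms(1) by (metis bezout_coefficients_fst_snd coprime_iff_gcd_eq_1)
  then have "f = poly_Diff (a * p + b * q) f"
    by simp
  also have "\<dots> = 0"
    using assms(2,3) by (simp add: ker_Diff_def poly_Diff_add_poly poly_Diff_mult)
  finally show ?thesis .
qed

lemma ker_Diff_coprime_mult:
  assumes "coprime p q" "f \<in> ker_Diff (p * q)"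
  obtains g h where "g \<in> ker_Diff p" "h \<in> ker_Diff q" "f = g + h"
proof -
  obtain a b where ab: "a * p + b * q = 1"
    using assms(1) by (metis bezout_coefficients_fst_snd coprime_iff_gcd_eq_1)
  have f: "f \<in> C_infinity" "poly_Diff (p * q) f = 0"
    using assms(2) by (auto simp: ker_Diff_def)
  \<comment> \<open>Commutativity of polynomial multiplication moves \<open>p\<close> next to
    \<open>q\<close>, so that \<open>p * q\<close> acts on \<open>f\<close> first and gives
    0.\<close>
  have "poly_Diff p (poly_Diff (b * q) f) = poly_Diff (b * (p * q)) f"
    using f by (simp add: poly_Diff_mult[symmetric] ac_simps)
  moreover have "poly_Diff q (poly_Diff (a * p) f) = poly_Diff (a * (p * q)) f"
    using f by (simp add: poly_Diff_mult[symmetric] ac_simps)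
  moreover have "f = poly_Diff (b * q) f + poly_Diff (a * p) f"
    using ab by (metis poly_Diff_add_poly poly_Diff_1 add.commute)
  ultimately show thesis
    using f by (intro that[of "poly_Diff (b * q) f" "poly_Diff (a * p) f"])
      (auto simp: ker_Diff_def C_infinity_closed poly_Diff_mult)
qed

lemma ker_Diff_prod_sum:
  assumes "finite I" "\<And>i j. i \<in> I \<Longrightarrow> j \<in> I \<Longrightarrow> i \<noteq> j \<Longrightarrow> coprime (q i) (q j)"
    and "f \<in> ker_Diff (\<Prod>i\<in>I. q i)"
  shows "\<exists>w. (\<forall>i\<in>I. w i \<in> ker_Diff (q i)) \<and> f = (\<Sum>i\<in>I. w i)"
  using assms
proof (induction I arbitrary: f rule: finite_induct)
  \<comment> \<open>The empty product is 1, whose kernel contains only the zero function, that is,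
    the empty sum.\<close>
  case empty
  then show ?case by (simp add: ker_Diff_def)
next
  case (insert i I)
  have "coprime (q i) (\<Prod>j\<in>I. q j)"
    using insert by (intro prod_coprime_right) auto
  moreover have "f \<in> ker_Diff (q i * (\<Prod>j\<in>I. q j))"
    using insert by simp
  ultimately obtain g h where gh: "g \<in> ker_Diff (q i)" "h \<in> ker_Diff (\<Prod>j\<in>I. q j)" "f = g + h"
    by (rule ker_Diff_coprime_mult)
  obtain w where w: "\<forall>j\<in>I. w j \<in> ker_Diff (q j)" "h = (\<Sum>j\<in>I. w j)"
    using insert.IH[OF _ gh(2)] insert.prems by blast
  have "(\<Sum>j\<in>I. (w(i := g)) j) = (\<Sum>j\<in>I. w j)"
    using insert by (intro sum.cong) auto
  then show ?case
    using insert w gh by (intro exI[of _ "w(i := g)"]) auto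
qed

text \<open>Solving for \<open>w i\<close> places it in the kernel of the product of the other
  factors, which is coprime to \<open>q i\<close>. This gives uniqueness of components and, later,
  linear independence.\<close>

lemma ker_Diff_sum_zero:
  assumes "finite I" "\<And>i j. i \<in> I \<Longrightarrow> j \<in> I \<Longrightarrow> i \<noteq> j \<Longrightarrow> coprime (q i) (q j)"
    and w: "\<And>i. i \<in> I \<Longrightarrow> w i \<in> ker_Diff (q i)" and sum: "(\<Sum>i\<in>I. w i) = 0" and i: "i \<in> I"
  shows "w i = 0"
proof (rule ker_Diff_coprime_Int)
  show "coprime (q i) (\<Prod>j\<in>I - {i}. q j)"
    using assms by (intro prod_coprime_right) auto
  show "w i \<in> ker_Diff (q i)"
    using w i .
  have "w j \<in> ker_Diff (\<Prod>j\<in>I - {i}. q j)" if "j \<in> I - {i}" for j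
    using that w ker_Diff_mono[OF dvd_prodI[of "I - {i}" j q]] assms(1) by auto
  then have "- (\<Sum>j\<in>I - {i}. w j) \<in> ker_Diff (\<Prod>j\<in>I - {i}. q j)"
    by (intro cfun.subspace_neg cfun.subspace_sum ker_Diff_subspace)
  moreover have "w i = - (\<Sum>j\<in>I - {i}. w j)"
    using sum i assms(1) by (simp add: sum.remove eq_neg_iff_add_eq_0)
  ultimately show "w i \<in> ker_Diff (\<Prod>j\<in>I - {i}. q j)"
    by simp
qed

lemma ker_Diff_prod_direct_sum:
  assumes "finite I" "\<And>i j. i \<in> I \<Longrightarrow> j \<in> I \<Longrightarrow> i \<noteq> j \<Longrightarrow> coprime (q i) (q j)"
  shows "is_direct_sum (ker_Diff (\<Prod>i\<in>I. q i)) I (\<lambda>i. ker_Diff (q i))"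
  unfolding is_direct_sum_def
proof (intro conjI ballI ker_Diff_subspace ker_Diff_mono)
  fix f assume "f \<in> ker_Diff (\<Prod>i\<in>I. q i)"
  then obtain w where w: "\<forall>i\<in>I. w i \<in> ker_Diff (q i)" "f = (\<Sum>i\<in>I. w i)"
    using ker_Diff_prod_sum[of I q f] assms by blast
  show "\<exists>!w. w \<in> (\<Pi>\<^sub>E i\<in>I. ker_Diff (q i)) \<and> f = (\<Sum>i\<in>I. w i)"
  proof (rule ex1I)
    \<comment> \<open>Restriction makes the family extensional, as membership in the dependent
      product demands.\<close>
    show "restrict w I \<in> (\<Pi>\<^sub>E i\<in>I. ker_Diff (q i)) \<and> f = (\<Sum>i\<in>I. restrict w I i)"
      using w by auto
  next
    fix u assume u: "u \<in> (\<Pi>\<^sub>E i\<in>I. ker_Diff (q i)) \<and> f = (\<Sum>i\<in>I. u i)"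
    have "u i - w i = 0" if "i \<in> I" for i
      using assms
    proof (rule ker_Diff_sum_zero[OF _ _ _ _ that])
      show "u i - w i \<in> ker_Diff (q i)" if "i \<in> I" for i
        using u w that by (intro cfun.subspace_diff ker_Diff_subspace) auto
      show "(\<Sum>i\<in>I. u i - w i) = 0"
        using u w by (simp add: sum_subtractf)
    qed
    then show "u = restrict w I"
      using u by (intro extensionalityI[of u I]) (auto simp: PiE_def)
  qed
qed (use assms in \<open>auto intro: dvd_prodI\<close>)

section \<open>Polynomials times an exponential\<close>

definition poly_exp :: "complex \<Rightarrow> complex poly \<Rightarrow> real \<Rightarrow> complex"
  where "poly_exp l P = (\<lambda>x. poly P (of_real x) * exp (l * of_real x))"

lemma poly_exp_0 [simp]: "poly_exp l 0 = 0"
  by (simp add: poly_exp_def zero_fun_def)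

lemma poly_exp_add: "poly_exp l (P + Q) = poly_exp l P + poly_exp l Q"
  by (simp add: poly_exp_def plus_fun_def algebra_simps)

lemma poly_exp_smult: "poly_exp l (smult c P) = fun_scale c (poly_exp l P)"
  by (simp add: poly_exp_def fun_scale_def algebra_simps)

lemma poly_exp_sum: "poly_exp l (\<Sum>i\<in>I. P i) = (\<Sum>i\<in>I. poly_exp l (P i))"
  by (induction I rule: infinite_finite_induct) (auto simp: poly_exp_add)

text \<open>The exponential has no zeros, so \<open>P\<close> would vanish at all real numbers,
  which are infinitely many points of the complex plane.\<close>

lemma poly_exp_eq_0_iff: "poly_exp l P = 0 \<longleftrightarrow> P = 0"
proof
  assume "poly_exp l P = 0"
  then have "poly P (of_real x) = 0" for x
    by (auto simp: poly_exp_def zero_fun_def fun_eq_iff)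
  then have "range (of_real :: real \<Rightarrow> complex) \<subseteq> {z. poly P z = 0}"
    by auto
  moreover have "infinite (range (of_real :: real \<Rightarrow> complex))"
    by (simp add: finite_image_iff inj_on_def infinite_UNIV_char_0)
  ultimately show "P = 0"
    using poly_roots_finite finite_subset by blast
qed auto

lemma poly_exp_has_vector_derivative:
  "(poly_exp l P has_vector_derivative poly_exp l (pderiv P + smult l P) x) (at x)"
proof -
  \<comment> \<open>The function is differentiated as a function of a complex variable and then
    restricted to the real line.\<close>
  have "((\<lambda>z. poly P z * exp (l * z)) has_field_derivative
      poly (pderiv P + smult l P) z * exp (l * z)) (at z)" for z
    by (auto intro!: derivative_eq_intros simp: algebra_simps)
  from has_vector_derivative_real_field[OF this] show ?thesis
    by (simp add: poly_exp_def)
qed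

lemma Diff_poly_exp: "Diff (poly_exp l P) = poly_exp l (pderiv P + smult l P)"
  unfolding Diff_def using vector_derivative_at[OF poly_exp_has_vector_derivative] by (intro ext)

lemma poly_exp_in_C_infinity: "poly_exp l P \<in> C_infinity"
proof -
  have "range (poly_exp l) \<subseteq> C_infinity"
    by (rule Diff_closed_subset_C_infinity)
      (auto simp: Diff_poly_exp intro: differentiableI_vector poly_exp_has_vector_derivative)
  then show ?thesis by auto
qed

section \<open>The kernel of a power of D - l\<close>

lemma poly_Diff_linear: "poly_Diff [:- l, 1:] f = Diff f - fun_scale l f"
  by (simp add: poly_Diff_pCons)

lemma poly_Diff_linear_poly_exp: "poly_Diff [:- l, 1:] (poly_exp l P) = poly_exp l (pderiv P)"
  by (simp add: poly_Diff_linear Diff_poly_exp poly_exp_add poly_exp_smult)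

text \<open>Integrating factor: multiplying \<open>f\<close> by exp(-l x), here
  \<open>poly_exp (- l) 1\<close>, gives a function with zero derivative, hence a constant.\<close>

lemma ker_Diff_linear:
  assumes "f \<in> ker_Diff [:- l, 1:]"
  obtains c where "f = poly_exp l [:c:]"
proof -
  have f: "f differentiable (at x)" for x
    using assms by (auto simp: ker_Diff_def C_infinity_def dest: spec[of _ 0])
  have "Diff f = fun_scale l f"
    using assms by (simp add: ker_Diff_def poly_Diff_linear)
  then have f': "(f has_vector_derivative l * f x) (at x)" for x
    using f[of x] by (simp add: vector_derivative_works Diff_def fun_scale_def fun_eq_iff)
  have "((\<lambda>x. f x * poly_exp (- l) 1 x) has_vector_derivative 0) (at x)" for x
    using has_vector_derivative_mult[OF f' poly_exp_has_vector_derivative[of "- l" 1 x]]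
    by (simp add: poly_exp_def algebra_simps)
  then obtain c where c: "f x * poly_exp (- l) 1 x = c" for x
    using has_vector_derivative_zero_constant[of UNIV] by auto
  have "f x = c * exp (l * of_real x)" for x
    using c[of x] by (simp add: poly_exp_def exp_minus field_simps)
  then show thesis
    by (intro that[of c]) (auto simp: poly_exp_def)
qed

text \<open>Antidifferentiation term by term; characteristic 0 permits division by
  \<open>Suc i\<close>. The degree bound feeds the induction on the exponent.\<close>

lemma pderiv_surj:
  fixes P :: "'a::field_char_0 poly"
  obtains Q where "pderiv Q = P" "degree Q \<le> Suc (degree P)"
proof
  let ?Q = "\<Sum>i\<le>degree P. monom (coeff P i / of_nat (Suc i)) (Suc i)"
  have "pderiv ?Q = (\<Sum>i\<le>degree P. monom (coeff P i) i)"
    by (simp add: higher_pderiv_sum[of 1, simplified] pderiv_monom del: of_nat_Suc)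
  then show "pderiv ?Q = P"
    by (simp add: poly_as_sum_of_monoms)
  show "degree ?Q \<le> Suc (degree P)"
    by (intro degree_sum_le) (auto intro: order.trans[OF degree_monom_le])
qed

text \<open>The induction starts at 1 because for \<open>m = 0\<close> the right-hand side would be
  empty, whereas the kernel of the polynomial 1 is {0}.\<close>

lemma ker_Diff_linear_power:
  assumes "m \<ge> 1"
  shows "ker_Diff ([:- l, 1:] ^ m) = poly_exp l ` {P. degree P < m}"
  using assms
proof (induction m rule: nat_induct_at_least)
  case base
  show ?case
  proof (intro equalityI subsetI)
    fix f assume "f \<in> ker_Diff ([:- l, 1:] ^ 1)"
    then obtain c where "f = poly_exp l [:c:]"
      using ker_Diff_linear[of f l] by auto
    then show "f \<in> poly_exp l ` {P. degree P < 1}"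
      by auto
  next
    fix f assume "f \<in> poly_exp l ` {P. degree P < 1}"
    then show "f \<in> ker_Diff ([:- l, 1:] ^ 1)"
      by (auto simp: ker_Diff_def poly_exp_in_C_infinity poly_Diff_linear_poly_exp
          pderiv_eq_0_iff[THEN iffD2])
  qed
next
  case (Suc m)
  \<comment> \<open>One factor is split off on the right, so that it acts on \<open>f\<close> first
    and the induction hypothesis describes its result.\<close>
  have step: "f \<in> ker_Diff ([:- l, 1:] ^ Suc m) \<longleftrightarrow>
      f \<in> C_infinity \<and> poly_Diff [:- l, 1:] f \<in> ker_Diff ([:- l, 1:] ^ m)" for f
    by (cases "f \<in> C_infinity")
      (simp_all only: ker_Diff_def mem_Collect_eq power_Suc2 poly_Diff_mult C_infinity_closed simp_thms)
  show ?case
  proof (intro equalityI subsetI)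
    fix f assume "f \<in> ker_Diff ([:- l, 1:] ^ Suc m)"
    then obtain P where P: "f \<in> C_infinity" "degree P < m" "poly_Diff [:- l, 1:] f = poly_exp l P"
      unfolding step Suc.IH by auto
    obtain Q where Q: "pderiv Q = P" "degree Q \<le> Suc (degree P)"
      by (rule pderiv_surj)
    \<comment> \<open>\<open>poly_exp l Q\<close> is a particular solution of the equation (D - l) h
      = \<open>poly_exp l P\<close>. Subtracting it from \<open>f\<close> leaves a solution of the
      homogeneous equation, whose constant is then absorbed into \<open>Q\<close>.\<close>
    define g where "g = f + poly_exp l (- Q)"
    have "poly_Diff [:- l, 1:] g = poly_exp l (P + pderiv (- Q))"
      unfolding g_def poly_exp_add
      by (simp only: poly_Diff_add P poly_exp_in_C_infinity poly_Diff_linear_poly_exp)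
    then have "g \<in> ker_Diff [:- l, 1:]"
      using P(1) Q(1)
      by (simp add: ker_Diff_def pderiv_minus g_def C_infinity_closed poly_exp_in_C_infinity)
    then obtain c where "g = poly_exp l [:c:]"
      by (rule ker_Diff_linear)
    moreover have "f = g + poly_exp l Q"
      by (simp add: g_def add.assoc flip: poly_exp_add)
    ultimately have "f = poly_exp l (Q + [:c:])"
      by (simp only: poly_exp_add add.commute)
    moreover have "degree (Q + [:c:]) < Suc m"
      using P Q by (intro degree_add_less) auto
    ultimately show "f \<in> poly_exp l ` {P. degree P < Suc m}"
      by auto
  next
    fix f assume "f \<in> poly_exp l ` {P. degree P < Suc m}"
    then obtain P where "degree P < Suc m" "f = poly_exp l P"
      by auto
    \<comment> \<open>For constant \<open>P\<close> the degree of the derivative is 0 and does not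
      drop, so \<open>m >= 1\<close> is what gives the bound.\<close>
    moreover from this have "degree (pderiv P) < m"
      using Suc.hyps by (simp add: degree_pderiv)
    ultimately show "f \<in> ker_Diff ([:- l, 1:] ^ Suc m)"
      unfolding step Suc.IH by (auto simp: poly_exp_in_C_infinity poly_Diff_linear_poly_exp)
  qed
qed

section \<open>Independence and spanning of the exponential monomials\<close>

lemma coprime_linear_powers:
  fixes a b :: "'a::field_gcd"
  assumes "a \<noteq> b"
  shows "coprime ([:- a, 1:] ^ m) ([:- b, 1:] ^ n)"
proof (intro coprime_power_left_iff[THEN iffD2] coprime_power_right_iff[THEN iffD2] disjI1)
  show "coprime [:- a, 1:] [:- b, 1:]"
  proof (rule coprimeI)
    fix c assume "c dvd [:- a, 1:]" "c dvd [:- b, 1:]"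
    \<comment> \<open>The difference is the nonzero constant \<open>b - a\<close>, hence a
      unit.\<close>
    then have "c dvd [:- a, 1:] - [:- b, 1:]"
      by (rule dvd_diff)
    then show "is_unit c"
      using assms by (auto intro: dvd_unit_imp_unit simp: is_unit_triv)
  qed
qed

text \<open>Injectivity of the indexing is needed to turn a sum over the set of functions into a sum
  over pairs. Grouping that sum by exponent \<open>lam j\<close>, coprimality of the factors makes
  each group vanish, and then each polynomial coefficient vanishes.\<close>

lemma exp_monomials_independent:
  assumes "finite I" "inj_on lam I"
  shows "inj_on (\<lambda>(j, k). poly_exp (lam j) (monom 1 k)) (SIGMA j:I. {..<m j})"
    and "cfun.independent ((\<lambda>(j, k). poly_exp (lam j) (monom 1 k)) ` (SIGMA j:I. {..<m j}))"
proof -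
  let ?E = "\<lambda>(j, k). poly_exp (lam j) (monom 1 k)"
  let ?S = "SIGMA j:I. {..<m j}"
  \<comment> \<open>\<open>m j\<close> may be 0 here. Raising the exponent to
    \<open>Suc (m j)\<close> makes the description of the kernel available, and the larger kernels
    are still independent.\<close>
  have cop: "coprime ([:- lam i, 1:] ^ Suc (m i)) ([:- lam j, 1:] ^ Suc (m j))"
    if "i \<in> I" "j \<in> I" "i \<noteq> j" for i j
    using that assms(2) by (intro coprime_linear_powers) (auto dest: inj_onD)
  have mem: "poly_exp (lam j) P \<in> ker_Diff ([:- lam j, 1:] ^ Suc (m j))"
    if "degree P < Suc (m j)" for j P
    using that by (subst ker_Diff_linear_power) auto
  show inj: "inj_on ?E ?S"
  proof (rule inj_onI, safe)
    fix i k j n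
    assume *: "i \<in> I" "j \<in> I" "k < m i" "n < m j"
      "poly_exp (lam i) (monom 1 k) = poly_exp (lam j) (monom 1 n)"
    show ij: "i = j"
    proof (rule ccontr)
      assume "i \<noteq> j"
      have "poly_exp (lam i) (monom 1 k) \<in> ker_Diff ([:- lam i, 1:] ^ Suc (m i))"
        using * by (intro mem) (simp add: degree_monom_eq)
      \<comment> \<open>By the assumed equality the same function is also a monomial times the
        exponential for \<open>lam j\<close>.\<close>
      moreover have "poly_exp (lam i) (monom 1 k) \<in> ker_Diff ([:- lam j, 1:] ^ Suc (m j))"
        unfolding * using * by (intro mem) (simp add: degree_monom_eq)
      ultimately have "poly_exp (lam i) (monom 1 k) = 0"
        by (rule ker_Diff_coprime_Int[OF cop[OF *(1,2) \<open>i \<noteq> j\<close>]])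
      then show False
        by (simp add: poly_exp_eq_0_iff)
    qed
    have "poly_exp (lam i) (monom 1 k + smult (- 1) (monom 1 n)) = 0"
      using * ij unfolding poly_exp_add poly_exp_smult by simp
    then have "monom (1::complex) k = monom 1 n"
      by (simp add: poly_exp_eq_0_iff)
    then show "k = n"
      by (simp add: monom_eq_iff')
  qed
  show "cfun.independent (?E ` ?S)"
  proof (rule cfun.independent_if_scalars_zero)
    show "finite (?E ` ?S)"
      using assms by auto
    fix c b
    assume zero: "(\<Sum>b\<in>?E ` ?S. fun_scale (c b) b) = 0" and b: "b \<in> ?E ` ?S"
    \<comment> \<open>\<open>P j\<close> collects the coefficients of all terms with exponent
      \<open>lam j\<close>; the scalars \<open>c\<close> are indexed by functions, hence the detour
      through \<open>?E\<close>.\<close>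
    define P where "P j = (\<Sum>k<m j. monom (c (?E (j, k))) k)" for j
    have "0 = (\<Sum>(j, k)\<in>?S. fun_scale (c (?E (j, k))) (?E (j, k)))"
      using zero by (subst (asm) sum.reindex[OF inj]) (simp add: case_prod_unfold)
    also have "\<dots> = (\<Sum>j\<in>I. \<Sum>k<m j. fun_scale (c (?E (j, k))) (?E (j, k)))"
      using assms by (simp add: sum.Sigma)
    also have "\<dots> = (\<Sum>j\<in>I. poly_exp (lam j) (P j))"
      by (simp add: P_def poly_exp_sum smult_monom flip: poly_exp_smult)
    finally have *: "(\<Sum>j\<in>I. poly_exp (lam j) (P j)) = 0"
      by simp
    obtain j k where jk: "j \<in> I" "k < m j" "b = ?E (j, k)"
      using b by auto
    have deg: "degree (P j) < Suc (m j)" for j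
      unfolding P_def
      by (intro le_imp_less_Suc degree_sum_le) (auto intro: order.trans[OF degree_monom_le])
    have "poly_exp (lam j) (P j) = 0"
      by (rule ker_Diff_sum_zero[OF assms(1) cop mem[OF deg] * jk(1)])
    then have "coeff (P j) k = 0"
      by (simp add: poly_exp_eq_0_iff)
    moreover have "coeff (P j) k = c b"
      using jk by (simp add: P_def coeff_sum sum.delta)
    ultimately show "c b = 0"
      by simp
  qed
qed

text \<open>A kernel element splits into components, each a polynomial times an exponential that
  expands into monomials. Conversely each generator is killed by its own factor, hence by the
  product.\<close>

lemma ker_Diff_prod_eq_span:
  assumes I: "finite I" and inj: "inj_on lam I" and m: "\<And>j. j \<in> I \<Longrightarrow> m j \<ge> 1"
  shows "ker_Diff (\<Prod>j\<in>I. [:- lam j, 1:] ^ m j)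
    = cfun.span ((\<lambda>(j, k). poly_exp (lam j) (monom 1 k)) ` (SIGMA j:I. {..<m j}))"
    (is "?K = cfun.span ?B")
proof (intro equalityI subsetI)
  fix f assume "f \<in> ?K"
  moreover have "coprime ([:- lam i, 1:] ^ m i) ([:- lam j, 1:] ^ m j)"
    if "i \<in> I" "j \<in> I" "i \<noteq> j" for i j
    using that inj by (intro coprime_linear_powers) (auto dest: inj_onD)
  ultimately obtain w where w: "\<forall>j\<in>I. w j \<in> ker_Diff ([:- lam j, 1:] ^ m j)" "f = (\<Sum>j\<in>I. w j)"
    using ker_Diff_prod_sum[OF I, of "\<lambda>j. [:- lam j, 1:] ^ m j" f] by blast
  have "w j \<in> cfun.span ?B" if j: "j \<in> I" for j
  proof -
    have "w j \<in> poly_exp (lam j) ` {P. degree P < m j}"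
      using w(1) j ker_Diff_linear_power[OF m[OF j], of "lam j"] by blast
    then obtain P where P: "degree P < m j" "w j = poly_exp (lam j) P"
      by auto
    have "w j = poly_exp (lam j) (\<Sum>k\<le>degree P. smult (coeff P k) (monom 1 k))"
      by (simp add: P smult_monom poly_as_sum_of_monoms)
    also have "\<dots> = (\<Sum>k\<le>degree P. fun_scale (coeff P k) (poly_exp (lam j) (monom 1 k)))"
      by (simp only: poly_exp_sum poly_exp_smult)
    also have "\<dots> \<in> cfun.span ?B"
      using P j by (intro cfun.span_sum cfun.span_scale cfun.span_base) force
    finally show ?thesis .
  qed
  then show "f \<in> cfun.span ?B"
    unfolding w(2) by (rule cfun.span_sum)
next
  have "poly_exp (lam j) (monom 1 k) \<in> ?K" if "j \<in> I" "k < m j" for j k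
  proof -
    have "poly_exp (lam j) (monom 1 k) \<in> ker_Diff ([:- lam j, 1:] ^ m j)"
      using that m by (subst ker_Diff_linear_power) (auto simp: degree_monom_eq)
    then show ?thesis
      using ker_Diff_mono[OF dvd_prodI[OF I that(1), of "\<lambda>j. [:- lam j, 1:] ^ m j"]] by auto
  qed
  then have "?B \<subseteq> ?K"
    by auto
  then show "f \<in> ?K" if "f \<in> cfun.span ?B" for f
    using that cfun.span_minimal[OF _ ker_Diff_subspace] by blast
qed

theorem corollary3p5:
  fixes r :: nat and lam :: "nat \<Rightarrow> complex" and m :: "nat \<Rightarrow> nat" and p :: "complex poly"
  assumes "r \<ge> 1"
    and "inj_on lam {1..r}"
    and "\<And>j. j \<in> {1..r} \<Longrightarrow> m j \<ge> 1"
    and "p = (\<Prod>j=1..r. [:- lam j, 1:] ^ m j)"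
  shows "is_direct_sum (ker_Diff p) {1..r} (\<lambda>j. ker_Diff ([:- lam j, 1:] ^ m j))
    \<and> is_basis {(\<lambda>x::real. of_real x ^ k * exp (lam j * of_real x)) | k j. k \<le> m j - 1 \<and> 1 \<le> j \<and> j \<le> r}
        (ker_Diff p)
    \<and> ker_Diff p =
        cfun.span {(\<lambda>x::real. of_real x ^ k * exp (lam j * of_real x)) | k j. k \<le> m j - 1 \<and> 1 \<le> j \<and> j \<le> r}"
    (is "_ \<and> is_basis ?B _ \<and> _")
proof -
  let ?B' = "(\<lambda>(j, k). poly_exp (lam j) (monom 1 k)) ` (SIGMA j:{1..r}. {..<m j})"
  \<comment> \<open>With truncated subtraction, \<open>k <= m j - 1\<close> means
    \<open>k < m j\<close> only because \<open>m j >= 1\<close>.\<close>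
  have "k \<le> m j - 1 \<and> 1 \<le> j \<and> j \<le> r \<longleftrightarrow> (j, k) \<in> (SIGMA j:{1..r}. {..<m j})" for j k
    using assms(3)[of j] by auto
  then have "?B = {poly_exp (lam j) (monom 1 k) | k j. (j, k) \<in> (SIGMA j:{1..r}. {..<m j})}"
    by (simp only: poly_exp_def poly_monom mult_1)
  also have "\<dots> = ?B'"
    by (auto simp: image_iff) blast
  finally have B: "?B = ?B'" .
  have ker: "ker_Diff p = cfun.span ?B'"
    unfolding assms(4) using assms(2,3) by (intro ker_Diff_prod_eq_span) auto
  have "is_basis ?B' (ker_Diff p)"
    unfolding is_basis_def ker
    using exp_monomials_independent(2)[OF _ assms(2)] by (auto intro: cfun.span_base)
  moreover have "is_direct_sum (ker_Diff p) {1..r} (\<lambda>j. ker_Diff ([:- lam j, 1:] ^ m j))"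
    unfolding assms(4) using assms(2)
    by (intro ker_Diff_prod_direct_sum coprime_linear_powers) (auto dest: inj_onD)
  ultimately show ?thesis
    unfolding B using ker by blast
qed

end
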